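(* Let $A$ be a set of cardinality at least two, let $(\Gamma_a)_{a\in A}$ be a family of non-trivial groups, and let $\Gamma=\mathop{*}_{a\in A}\Gamma_a$ be their free product. Then any completely metrizable group topology on $\Gamma$ is discrete.
   Context: $\mathop{*}_{a\in A}\Gamma_a$ denotes the free product of the groups $\Gamma_a$. A completely metrizable group topology on a group is a topology that makes it a topological group and is induced by some complete metric. *)

theory Defs
  imports "HOL-Analysis.Analysis" "HOL-Algebra.Group"
begin

text \<open>
  The free product of a family of groups is realised on reduced words: a letter \<open>(a, g)\<close> is an
  element \<open>g \<noteq> \<one>\<close> of the factor \<open>G a\<close>, and neighbouring letters come from different factors.
  The identity is the empty word.
\<close>

definition reduced_words :: "'i set \<Rightarrow> ('i \<Rightarrow> ('g, 'm) monoid_scheme) \<Rightarrow> ('i \<times> 'g) list set"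
  where "reduced_words A G =
    {w. (\<forall>(a, g) \<in> set w. a \<in> A \<and> g \<in> carrier (G a) \<and> g \<noteq> \<one>\<^bsub>G a\<^esub>) \<and> distinct_adj (map fst w)}"

text \<open>Left multiplication of a reduced word by an element of one factor (which may be \<open>\<one>\<close>).\<close>

fun prepend :: "('i \<Rightarrow> ('g, 'm) monoid_scheme) \<Rightarrow> 'i \<times> 'g \<Rightarrow> ('i \<times> 'g) list \<Rightarrow> ('i \<times> 'g) list"
  where
    "prepend G (a, g) [] = (if g = \<one>\<^bsub>G a\<^esub> then [] else [(a, g)])"
  | "prepend G (a, g) ((b, h) # w) =
      (if g = \<one>\<^bsub>G a\<^esub> then (b, h) # w
       else if a = b then (if g \<otimes>\<^bsub>G a\<^esub> h = \<one>\<^bsub>G a\<^esub> then w else (a, g \<otimes>\<^bsub>G a\<^esub> h) # w)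
       else (a, g) # (b, h) # w)"

definition free_product :: "'i set \<Rightarrow> ('i \<Rightarrow> ('g, 'm) monoid_scheme) \<Rightarrow> ('i \<times> 'g) list monoid"
  where "free_product A G =
    \<lparr>carrier = reduced_words A G, monoid.mult = (\<lambda>u v. foldr (prepend G) u v), one = []\<rparr>"

definition free_product_incl :: "('i \<Rightarrow> ('g, 'm) monoid_scheme) \<Rightarrow> 'i \<Rightarrow> 'g \<Rightarrow> ('i \<times> 'g) list"
  where "free_product_incl G a g = prepend G (a, g) []"

definition group_topology :: "('a, 'b) monoid_scheme \<Rightarrow> 'a topology \<Rightarrow> bool"
  where "group_topology G T \<longleftrightarrow>
    topspace T = carrier G \<and>
    continuous_map (prod_topology T T) T (\<lambda>(x, y). x \<otimes>\<^bsub>G\<^esub> y) \<and>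
    continuous_map T T (\<lambda>x. inv\<^bsub>G\<^esub> x)"


lemma reduced_words_Nil [simp]: "[] \<in> reduced_words A G"
  by (simp add: reduced_words_def)

lemma reduced_words_Cons:
  "(a, g) # w \<in> reduced_words A G \<longleftrightarrow>
    a \<in> A \<and> g \<in> carrier (G a) \<and> g \<noteq> \<one>\<^bsub>G a\<^esub> \<and> w \<in> reduced_words A G \<and>
    (w = [] \<or> fst (hd w) \<noteq> a)"
  by (cases w) (auto simp: reduced_words_def)

lemma prepend_reduced:
  assumes "(a, g) # w \<in> reduced_words A G"
  shows "prepend G (a, g) w = (a, g) # w"
  using assms by (cases w) (auto simp: reduced_words_Cons)

lemma foldr_prepend_Nil:
  assumes "w \<in> reduced_words A G"
  shows "foldr (prepend G) w [] = w"
  using assms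
proof (induction w)
  case (Cons x w)
  then show ?case
    by (cases x) (auto simp: reduced_words_Cons prepend_reduced)
qed simp

lemma prepend_one: "prepend G (a, \<one>\<^bsub>G a\<^esub>) w = w"
  by (cases w) auto

context
  fixes A :: "'i set" and G :: "'i \<Rightarrow> ('g, 'm) monoid_scheme"
  assumes grp: "\<And>a. a \<in> A \<Longrightarrow> group (G a)"
begin

lemma prepend_closed:
  assumes "a \<in> A" "g \<in> carrier (G a)" "w \<in> reduced_words A G"
  shows "prepend G (a, g) w \<in> reduced_words A G"
proof -
  interpret group "G a" using assms(1) by (rule grp)
  show ?thesis
    using assms by (cases w) (auto simp: reduced_words_Cons)
qed

lemma prepend_prepend:
  assumes "a \<in> A" "g \<in> carrier (G a)" "h \<in> carrier (G a)" "w \<in> reduced_words A G"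
  shows "prepend G (a, g) (prepend G (a, h) w) = prepend G (a, g \<otimes>\<^bsub>G a\<^esub> h) w"
proof -
  interpret group "G a" using assms(1) by (rule grp)
  show ?thesis
  proof (cases w)
    case Nil
    then show ?thesis using assms by auto
  next
    case (Cons x w')
    obtain b k where x: "x = (b, k)" by (cases x)
    show ?thesis
    proof (cases "b = a")
      case False
      then show ?thesis using assms Cons x by auto
    next
      case True
      then have w': "(a, k) # w' \<in> reduced_words A G" "k \<in> carrier (G a)"
        using assms Cons x by (auto simp: reduced_words_Cons)
      have *: "prepend G (a, f) w = (if f \<otimes>\<^bsub>G a\<^esub> k = \<one>\<^bsub>G a\<^esub> then w' else (a, f \<otimes>\<^bsub>G a\<^esub> k) # w')"
        if "f \<in> carrier (G a)" for f
        using w' Cons x True that by (auto simp: reduced_words_Cons)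
      have w'3: "prepend G (a, g) w' = (if g = \<one>\<^bsub>G a\<^esub> then w' else (a, g) # w')"
        using w' by (cases w') (auto simp: reduced_words_Cons)
      have assoc: "(g \<otimes>\<^bsub>G a\<^esub> h) \<otimes>\<^bsub>G a\<^esub> k = g \<otimes>\<^bsub>G a\<^esub> (h \<otimes>\<^bsub>G a\<^esub> k)"
        using assms w' by (simp add: m_assoc)
      show ?thesis
      proof (cases "h \<otimes>\<^bsub>G a\<^esub> k = \<one>\<^bsub>G a\<^esub>")
        case True
        then show ?thesis using assms w'3 assoc by (simp add: *)
      next
        case False
        then show ?thesis using assms w' assoc by (simp add: *)
      qed
    qed
  qed
qed

lemma foldr_prepend_closed:
  assumes "u \<in> reduced_words A G" "w \<in> reduced_words A G"
  shows "foldr (prepend G) u w \<in> reduced_words A G"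
  using assms
proof (induction u)
  case (Cons x u)
  then show ?case
    by (cases x) (auto simp: reduced_words_Cons prepend_closed)
qed simp

lemma foldr_prepend_prepend:
  assumes "a \<in> A" "g \<in> carrier (G a)" "v \<in> reduced_words A G" "w \<in> reduced_words A G"
  shows "foldr (prepend G) (prepend G (a, g) v) w = prepend G (a, g) (foldr (prepend G) v w)"
proof (cases v)
  case Nil
  then show ?thesis by (simp add: prepend_one)
next
  case (Cons x v')
  obtain b h where x: "x = (b, h)" by (cases x)
  have v': "b \<in> A" "h \<in> carrier (G b)" "v' \<in> reduced_words A G"
    using assms Cons x by (auto simp: reduced_words_Cons)
  have "foldr (prepend G) v' w \<in> reduced_words A G"
    using v' assms by (simp add: foldr_prepend_closed)
  with v' show ?thesis
    using prepend_prepend[of a g h "foldr (prepend G) v' w"] assms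
    by (auto simp: Cons x prepend_one)
qed

lemma foldr_prepend_assoc:
  assumes "u \<in> reduced_words A G" "v \<in> reduced_words A G" "w \<in> reduced_words A G"
  shows "foldr (prepend G) (foldr (prepend G) u v) w
       = foldr (prepend G) u (foldr (prepend G) v w)"
  using assms
proof (induction u)
  case (Cons x u)
  then show ?case
    by (cases x) (auto simp: reduced_words_Cons foldr_prepend_prepend foldr_prepend_closed)
qed simp

lemma foldr_prepend_inverse:
  assumes "w \<in> reduced_words A G"
  shows "\<exists>y \<in> reduced_words A G. foldr (prepend G) y w = []"
  using assms
proof (induction w)
  case Nil
  then show ?case by (auto intro: bexI[of _ "[]"])
next
  case (Cons x w)
  obtain a g where x: "x = (a, g)" by (cases x)
  have a: "a \<in> A" "g \<in> carrier (G a)" "w \<in> reduced_words A G"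
    using Cons x by (auto simp: reduced_words_Cons)
  interpret group "G a" using a(1) by (rule grp)
  obtain y where y: "y \<in> reduced_words A G" "foldr (prepend G) y w = []"
    using Cons a by blast
  define i where "i = prepend G (a, inv\<^bsub>G a\<^esub> g) []"
  have i: "i \<in> reduced_words A G"
    unfolding i_def using a by (simp add: prepend_closed del: prepend.simps)
  have "foldr (prepend G) i (x # w) = prepend G (a, inv\<^bsub>G a\<^esub> g) (prepend G (a, g) w)"
    using foldr_prepend_prepend[of a "inv\<^bsub>G a\<^esub> g" "[]" "x # w"] a Cons.prems
      prepend_reduced[of a g w A G]
    by (simp add: i_def x)
  also have "\<dots> = w"
    using a by (simp add: prepend_prepend prepend_one)
  finally have "foldr (prepend G) (foldr (prepend G) y i) (x # w) = []"
    using foldr_prepend_assoc[OF y(1) i Cons.prems] y(2) by simp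
  then show ?case
    using foldr_prepend_closed[OF y(1) i] by blast
qed

theorem group_free_product: "group (free_product A G)"
  by (rule groupI)
    (auto simp: free_product_def foldr_prepend_closed foldr_prepend_assoc foldr_prepend_inverse)

lemma free_product_incl_hom:
  assumes "a \<in> A"
  shows "free_product_incl G a \<in> hom (G a) (free_product A G)"
proof (rule homI)
  fix g h assume gh: "g \<in> carrier (G a)" "h \<in> carrier (G a)"
  show "free_product_incl G a g \<in> carrier (free_product A G)"
    unfolding free_product_incl_def
    using assms gh by (simp add: free_product_def prepend_closed del: prepend.simps)
  have "foldr (prepend G) (prepend G (a, g) []) (prepend G (a, h) [])
      = prepend G (a, g) (prepend G (a, h) [])"
    using assms gh foldr_prepend_prepend[of a g "[]" "prepend G (a, h) []"]
    by (simp add: prepend_closed del: prepend.simps)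
  then show "free_product_incl G a (g \<otimes>\<^bsub>G a\<^esub> h) =
      free_product_incl G a g \<otimes>\<^bsub>free_product A G\<^esub> free_product_incl G a h"
    using assms gh prepend_prepend[of a g h "[]"]
    by (simp add: free_product_def free_product_incl_def del: prepend.simps)
qed

text \<open>The universal property, with uniqueness stated on the carrier.\<close>

theorem free_product_universal:
  fixes H :: "('h, 'n) monoid_scheme"
  assumes "group H" and \<phi>: "\<And>a. a \<in> A \<Longrightarrow> \<phi> a \<in> hom (G a) H"
  shows "\<exists>f \<in> hom (free_product A G) H.
      (\<forall>a \<in> A. \<forall>g \<in> carrier (G a). f (free_product_incl G a g) = \<phi> a g) \<and>
      (\<forall>f' \<in> hom (free_product A G) H.
        (\<forall>a \<in> A. \<forall>g \<in> carrier (G a). f' (free_product_incl G a g) = \<phi> a g) \<longrightarrow>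
        (\<forall>w \<in> carrier (free_product A G). f' w = f w))"
proof -
  interpret H: group H by fact
  define f where "f = (\<lambda>w. foldr (\<lambda>(a, g) y. \<phi> a g \<otimes>\<^bsub>H\<^esub> y) w \<one>\<^bsub>H\<^esub>)"
  have f_simps [simp]: "f [] = \<one>\<^bsub>H\<^esub>" "f ((a, g) # w) = \<phi> a g \<otimes>\<^bsub>H\<^esub> f w" for a g w
    by (simp_all add: f_def)
  have \<phi>_one: "\<phi> a \<one>\<^bsub>G a\<^esub> = \<one>\<^bsub>H\<^esub>" if "a \<in> A" for a
    using hom_one[OF \<phi>[OF that] grp[OF that] \<open>group H\<close>] .
  have \<phi>_closed: "\<phi> a g \<in> carrier H" if "a \<in> A" "g \<in> carrier (G a)" for a g
    using hom_in_carrier[OF \<phi>] that by blast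
  have f_closed: "f w \<in> carrier H" if "w \<in> reduced_words A G" for w
    using that by (induction w) (auto simp: reduced_words_Cons \<phi>_closed)
  have f_prepend: "f (prepend G (a, g) w) = \<phi> a g \<otimes>\<^bsub>H\<^esub> f w"
    if "a \<in> A" "g \<in> carrier (G a)" "w \<in> reduced_words A G" for a g w
  proof (cases w)
    case Nil
    then show ?thesis using that by (auto simp: \<phi>_one)
  next
    case (Cons x w')
    obtain b h where x: "x = (b, h)" by (cases x)
    have b: "b \<in> A" "h \<in> carrier (G b)" "w' \<in> reduced_words A G"
      using that Cons x by (auto simp: reduced_words_Cons)
    have *: "\<phi> a g \<otimes>\<^bsub>H\<^esub> (\<phi> a h \<otimes>\<^bsub>H\<^esub> f w') = \<phi> a (g \<otimes>\<^bsub>G a\<^esub> h) \<otimes>\<^bsub>H\<^esub> f w'"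
      if "b = a"
      using that b \<open>a \<in> A\<close> \<open>g \<in> carrier (G a)\<close> hom_mult[OF \<phi>, of a g h]
      by (simp add: H.m_assoc \<phi>_closed f_closed)
    show ?thesis
      using that b * by (auto simp: Cons x \<phi>_one \<phi>_closed f_closed)
  qed
  have f_hom: "f \<in> hom (free_product A G) H"
  proof (rule homI)
    fix u v assume uv: "u \<in> carrier (free_product A G)" "v \<in> carrier (free_product A G)"
    then show "f u \<in> carrier H" by (simp add: free_product_def f_closed)
    have "u \<in> reduced_words A G \<Longrightarrow> f (foldr (prepend G) u v) = f u \<otimes>\<^bsub>H\<^esub> f v"
    proof (induction u)
      case Nil
      then show ?case using uv by (simp add: f_closed free_product_def)
    next
      case (Cons x u)
      then show ?case
        using uv by (cases x) (auto simp: reduced_words_Cons f_prepend foldr_prepend_closed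
            free_product_def H.m_assoc f_closed \<phi>_closed)
    qed
    then show "f (u \<otimes>\<^bsub>free_product A G\<^esub> v) = f u \<otimes>\<^bsub>H\<^esub> f v"
      using uv by (simp add: free_product_def)
  qed
  have f_incl: "f (free_product_incl G a g) = \<phi> a g" if "a \<in> A" "g \<in> carrier (G a)" for a g
    using that f_prepend[of a g "[]"] by (simp add: free_product_incl_def \<phi>_closed del: prepend.simps)
  have f_unique: "f' w = f w"
    if f': "f' \<in> hom (free_product A G) H"
      and incl: "\<forall>a \<in> A. \<forall>g \<in> carrier (G a). f' (free_product_incl G a g) = \<phi> a g"
      and w: "w \<in> carrier (free_product A G)" for f' w
  proof -
    have "w \<in> reduced_words A G \<Longrightarrow> f' w = f w"
    proof (induction w)
      case Nil
      then show ?case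
        using hom_one[OF f' group_free_product \<open>group H\<close>] by (simp add: free_product_def)
    next
      case (Cons x w)
      obtain a g where x: "x = (a, g)" by (cases x)
      have a: "a \<in> A" "g \<in> carrier (G a)" "g \<noteq> \<one>\<^bsub>G a\<^esub>" "w \<in> reduced_words A G"
        using Cons x by (auto simp: reduced_words_Cons)
      have e: "x # w = free_product_incl G a g \<otimes>\<^bsub>free_product A G\<^esub> w"
        using a prepend_reduced[of a g w A G] Cons.prems
        by (simp add: free_product_def free_product_incl_def x)
      have "f' (x # w) = f' (free_product_incl G a g) \<otimes>\<^bsub>H\<^esub> f' w"
        unfolding e
        using a hom_in_carrier[OF free_product_incl_hom]
        by (intro hom_mult[OF f']) (auto simp: free_product_def)
      then show ?case using a Cons.IH incl by (simp add: x)
    qed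
    then show ?thesis using w by (simp add: free_product_def)
  qed
  show ?thesis
    using f_hom f_incl f_unique by blast
qed

end

end

theory Submission
  imports Defs
begin

text \<open>
  Fix a factor \<open>\<alpha>\<close> and let \<open>N w\<close> be the number of letters of the reduced word \<open>w\<close> that lie
  outside \<open>\<alpha>\<close>. This \<open>N\<close> is subadditive and invariant under inversion, it vanishes exactly on the
  factor \<open>H\<close> at \<open>\<alpha>\<close>, and \<open>N (y h y\<inverse>) = 2 N y\<close> for every non-trivial \<open>h \<in> H\<close> (lemma
  \<open>letters_outside_conjugate\<close>): at most a last letter of \<open>y\<close> in \<open>H\<close> merges with \<open>h\<close>, and every other
  letter of \<open>y\<close> survives on both sides. The discreteness follows from these properties of \<open>N\<close>
  (theorem \<open>discrete_if_length_doubles\<close>), as follows.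

  Fix \<open>h \<in> H\<close>, \<open>h \<noteq> \<one>\<close>. The map \<open>\<phi> y = y h y\<inverse> h\<inverse>\<close> is continuous, fixes \<open>\<one>\<close>, and satisfies
  \<open>N (\<phi> y) \<ge> 2 N y\<close>; hence its \<open>k\<close>-th iterate multiplies \<open>N\<close> by at least \<open>2\<^sup>k\<close>.
  Suppose that the topology is not discrete. Then every neighbourhood \<open>U\<close> of \<open>\<one>\<close> contains elements
  outside \<open>H\<close>: otherwise, for \<open>b \<notin> H\<close>, the neighbourhood \<open>U \<inter> b\<inverse> U b\<close> of \<open>\<one>\<close> lies in
  \<open>H \<inter> b\<inverse> H b\<close>, which is trivial by the doubling property.

  Completeness now permits an argument in the style of Dudley. Choosing \<open>g\<^sub>0, g\<^sub>1, \<dots> \<notin> H\<close> that tend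
  to \<open>\<one>\<close> fast enough, one solves the infinite system \<open>x\<^sub>n = g\<^sub>n \<cdot> \<phi>\<^sup>k (x\<^bsub>n+1\<^esub>)\<close>
  with \<open>k = N g\<^sub>n + 1\<close> simultaneously for all \<open>n\<close> (lemma \<open>nested_equations_solvable\<close>). Two
  consecutive \<open>x\<^sub>n\<close> and \<open>x\<^bsub>n+1\<^esub>\<close> cannot both lie in \<open>H\<close>, because \<open>g\<^sub>n\<close> does not; and if
  \<open>x\<^bsub>n+1\<^esub> \<notin> H\<close> then the growth under \<open>\<phi>\<close> outweighs \<open>g\<^sub>n\<close>, so that \<open>N x\<^sub>n > N x\<^bsub>n+1\<^esub>\<close>. Hence no
  \<open>x\<^sub>n\<close> lies in \<open>H\<close>, and \<open>N x\<^sub>0 > N x\<^sub>1 > \<dots>\<close> is an infinite strictly decreasing sequence of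
  natural numbers.
\<close>

section \<open>Infinite systems of equations in complete metric spaces\<close>

lemma (in Metric_space) MCauchy_if_geometric_steps:
  assumes "range \<sigma> \<subseteq> M" and step: "\<And>n. d (\<sigma> n) (\<sigma> (Suc n)) < (1/2) ^ n"
  shows "MCauchy \<sigma>"
proof -
  have mem: "\<sigma> n \<in> M" for n
    using assms(1) by auto
  have bound: "d (\<sigma> n) (\<sigma> (n + k)) \<le> 2 * (1/2) ^ n - 2 * (1/2) ^ (n + k)" for n k
  proof (induction k)
    case (Suc k)
    have "d (\<sigma> n) (\<sigma> (n + Suc k)) \<le> d (\<sigma> n) (\<sigma> (n + k)) + d (\<sigma> (n + k)) (\<sigma> (n + Suc k))"
      using triangle[OF mem mem mem] .
    then show ?case
      using Suc step[of "n + k"] by simp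
  qed (simp add: mem)
  have "\<exists>N. \<forall>n n'. N \<le> n \<longrightarrow> N \<le> n' \<longrightarrow> d (\<sigma> n) (\<sigma> n') < \<epsilon>" if "\<epsilon> > 0" for \<epsilon>
  proof -
    obtain N where N: "(1/2::real) ^ N < \<epsilon> / 4"
      using real_arch_pow_inv[of "\<epsilon> / 4" "1/2"] \<open>\<epsilon> > 0\<close> by auto
    have tail: "d (\<sigma> N) (\<sigma> n) < \<epsilon> / 2" if "N \<le> n" for n
    proof -
      have "(0::real) < (1/2) ^ n"
        by simp
      then show ?thesis
        using bound[of N "n - N"] that N unfolding le_add_diff_inverse[OF that] by linarith
    qed
    have "d (\<sigma> n) (\<sigma> n') < \<epsilon>" if "N \<le> n" "N \<le> n'" for n n'
    proof -
      have "d (\<sigma> n) (\<sigma> n') \<le> d (\<sigma> N) (\<sigma> n) + d (\<sigma> N) (\<sigma> n')"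
        by (rule triangle''[OF mem mem mem])
      then show ?thesis
        using tail[OF that(1)] tail[OF that(2)] by simp
    qed
    then show ?thesis
      by blast
  qed
  then show ?thesis
    using assms(1) unfolding MCauchy_def by blast
qed

text \<open>
  Solutions are limits of the truncated nestings \<open>w i n = F (b i) (\<dots> (F (b (n - 1)) e))\<close>, the
  empty nesting being \<open>e\<close>. Passing from \<open>w i n\<close> to \<open>w i (n + 1)\<close> replaces the innermost \<open>e\<close> by
  \<open>F (b n) e\<close>. When \<open>b n\<close> is chosen, only the finitely many continuous maps built from
  \<open>b 0, \<dots>, b (n - 1)\<close> are involved, so a choice with \<open>F (b n) e\<close> close enough to \<open>e\<close> moves every
  \<open>w i n\<close> by less than \<open>2\<^sup>-\<^sup>n\<close>.
\<close>

lemma nested_equations_solvable: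
  fixes F :: "'b \<Rightarrow> 'a \<Rightarrow> 'a"
  assumes complete: "completely_metrizable_space X"
    and e: "e \<in> topspace X"
    and cont: "\<And>b. b \<in> B \<Longrightarrow> continuous_map X X (F b)"
    and small: "\<And>U. openin X U \<Longrightarrow> e \<in> U \<Longrightarrow> \<exists>b \<in> B. F b e \<in> U"
  shows "\<exists>b x. \<forall>n::nat. b n \<in> B \<and> x n \<in> topspace X \<and> x n = F (b n) (x (Suc n))"
proof -
  obtain M d where "Metric_space M d" and M_complete: "Metric_space.mcomplete M d"
    and X: "X = Metric_space.mtopology M d"
    using complete unfolding completely_metrizable_space_def by blast
  interpret Metric_space M d by fact
  have eM: "e \<in> M"
    using e X by simp
  have cont_foldr: "continuous_map X X (foldr F bs)" if "set bs \<subseteq> B" for bs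
    using that
  proof (induction bs)
    case Nil
    then show ?case by (simp add: id_def)
  next
    case (Cons b bs)
    then show ?case
      using continuous_map_compose[of X X "foldr F bs" X "F b"] cont by (simp add: o_def)
  qed
  have foldr_M: "foldr F bs x \<in> M" if "set bs \<subseteq> B" "x \<in> M" for bs x
    using continuous_map_image_subset_topspace[OF cont_foldr[OF that(1)]] that(2) X by auto
  \<comment> \<open>The list \<open>bs\<close> holds the parameters chosen so far; dropping its first \<open>i\<close> entries gives the
    map that governs the \<open>i\<close>-th nesting.\<close>
  define good where "good bs b \<longleftrightarrow> b \<in> B \<and>
      (\<forall>i \<le> length bs. d (foldr F (drop i bs) e) (foldr F (drop i bs) (F b e)) < (1/2) ^ length bs)"
    for bs b
  have ex_good: "\<exists>b. good bs b" if bs: "set bs \<subseteq> B" for bs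
  proof -
    define V where "V i = {x \<in> topspace X. foldr F (drop i bs) x
        \<in> mball (foldr F (drop i bs) e) ((1/2) ^ length bs)}" for i
    have sub: "set (drop i bs) \<subseteq> B" for i
      using bs set_drop_subset by fastforce
    have "openin X (\<Inter>i \<in> {..length bs}. V i)"
    proof (rule openin_INT2)
      show "openin X (V i)" for i
        unfolding V_def
        by (rule openin_continuous_map_preimage[OF cont_foldr[OF sub]]) (simp add: X)
    qed auto
    moreover have "e \<in> (\<Inter>i \<in> {..length bs}. V i)"
      using e foldr_M[OF sub eM] by (auto simp: V_def)
    ultimately obtain b where "b \<in> B" "F b e \<in> (\<Inter>i \<in> {..length bs}. V i)"
      using small by blast
    then have "good bs b"
      by (auto simp: good_def V_def)
    then show ?thesis ..
  qed
  define history where "history = rec_nat [] (\<lambda>_ bs. bs @ [SOME b. good bs b])"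
  define b where "b n = (SOME c. good (history n) c)" for n
  have history_Suc: "history (Suc n) = history n @ [b n]" for n
    by (simp add: history_def b_def)
  have history_eq: "history n = map b [0..<n]" for n
  proof (induction n)
    case 0
    then show ?case by (simp add: history_def)
  qed (simp add: history_Suc)
  have history_B: "set (history n) \<subseteq> B" for n
  proof (induction n)
    case 0
    then show ?case by (simp add: history_def)
  next
    case (Suc n)
    then have "good (history n) (b n)"
      unfolding b_def using someI_ex[OF ex_good] by blast
    then show ?case
      using Suc by (simp add: history_Suc good_def)
  qed
  have good_b: "good (map b [0..<n]) (b n)" for n
    using someI_ex[OF ex_good[OF history_B[of n]]] unfolding b_def[of n] history_eq[of n] .
  then have bB: "b n \<in> B" for n
    by (simp add: good_def)
  define w where "w i n = foldr F (map b [i..<n]) e" for i n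
  have sub: "set (map b [i..<n]) \<subseteq> B" for i n
    using bB by auto
  have wM: "w i n \<in> M" for i n
    unfolding w_def by (rule foldr_M[OF sub eM])
  have w_step: "d (w i n) (w i (Suc n)) < (1/2) ^ n" for i n
  proof (cases "i \<le> n")
    case True
    have "drop i (map b [0..<n]) = map b [i..<n]"
      using True by (simp add: drop_map)
    then have "d (foldr F (map b [i..<n]) e) (foldr F (map b [i..<n]) (F (b n) e)) < (1/2) ^ n"
      using good_b[of n] True unfolding good_def by auto
    then show ?thesis
      using True by (simp add: w_def)
  next
    case False
    then show ?thesis
      using eM by (simp add: w_def)
  qed
  have "MCauchy (w i)" for i
    using wM by (intro MCauchy_if_geometric_steps w_step) auto
  then have "\<exists>x. limitin mtopology (w i) x sequentially" for i
    using M_complete unfolding mcomplete_def by simp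
  then obtain x where lim: "\<And>i. limitin mtopology (w i) (x i) sequentially"
    by metis
  have "x i = F (b i) (x (Suc i))" for i
  proof (rule limitin_metric_unique[OF lim])
    have "limitin mtopology (F (b i) \<circ> w (Suc i)) (F (b i) (x (Suc i))) sequentially"
      using continuous_map_limit[OF cont[OF bB[of i]] lim[of "Suc i", folded X]] unfolding X .
    moreover have "\<forall>\<^sub>F n in sequentially. (F (b i) \<circ> w (Suc i)) n = w i n"
      using eventually_gt_at_top[of i]
      by eventually_elim (simp add: w_def upt_conv_Cons)
    ultimately show "limitin mtopology (w i) (F (b i) (x (Suc i))) sequentially"
      by (rule limitin_transform_eventually[rotated])
  qed simp
  moreover have "x i \<in> topspace X" for i
    using limitin_topspace[OF lim[of i]] X by simp
  ultimately show ?thesis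
    using bB by blast
qed

section \<open>Groups with a length that doubles under conjugation\<close>

lemma (in group) continuous_map_group_mult:
  assumes "group_topology G T" "continuous_map X T f" "continuous_map X T g"
  shows "continuous_map X T (\<lambda>x. f x \<otimes> g x)"
proof -
  have "continuous_map (prod_topology T T) T (\<lambda>(x, y). x \<otimes> y)"
    using assms(1) by (simp add: group_topology_def)
  from continuous_map_compose[OF continuous_map_pairedI[OF assms(2,3)] this]
  show ?thesis
    by (simp add: o_def)
qed

lemma (in group) continuous_map_group_inv:
  assumes "group_topology G T" "continuous_map X T f"
  shows "continuous_map X T (\<lambda>x. inv (f x))"
  using continuous_map_compose[OF assms(2), of T "\<lambda>x. inv x"] assms(1)
  by (simp add: group_topology_def o_def)

lemma (in group) continuous_map_group_const:
  assumes "group_topology G T" "c \<in> carrier G"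
  shows "continuous_map X T (\<lambda>_. c)"
  using assms by (simp add: group_topology_def)

lemmas (in group) group_continuous_intros =
  continuous_map_group_mult continuous_map_group_inv continuous_map_group_const

lemma (in group) discrete_if_openin_one:
  assumes T: "group_topology G T" and one: "openin T {\<one>}"
  shows "T = discrete_topology (carrier G)"
proof -
  have top: "topspace T = carrier G"
    using T by (simp add: group_topology_def)
  have "openin T {x}" if x: "x \<in> carrier G" for x
  proof -
    have "continuous_map T T (\<lambda>y. inv x \<otimes> y)"
      using T x by (intro group_continuous_intros) auto
    from openin_continuous_map_preimage[OF this one]
    have "openin T {y \<in> carrier G. inv x \<otimes> y = \<one>}"
      by (simp add: top)
    moreover have "{y \<in> carrier G. inv x \<otimes> y = \<one>} = {x}"
      using x by (auto simp: inv_solve_left' inv_solve_left)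
    ultimately show ?thesis
      by simp
  qed
  then show ?thesis
    using top discrete_topology_unique[of "carrier G" T] by auto
qed

text \<open>
  The elements with \<open>N = 0\<close> play the role of a factor \<open>H\<close> in a free product, and the hypothesis on
  conjugates is a quantitative form of malnormality of \<open>H\<close>.
\<close>

theorem (in group) discrete_if_length_doubles:
  fixes N :: "'a \<Rightarrow> nat"
  assumes N_mult: "\<And>x y. x \<in> carrier G \<Longrightarrow> y \<in> carrier G \<Longrightarrow> N (x \<otimes> y) \<le> N x + N y"
    and N_inv: "\<And>x. x \<in> carrier G \<Longrightarrow> N (inv x) = N x"
    and N_conj: "\<And>h y. h \<in> carrier G \<Longrightarrow> h \<noteq> \<one> \<Longrightarrow> N h = 0 \<Longrightarrow> y \<in> carrier G
                    \<Longrightarrow> N (y \<otimes> h \<otimes> inv y) \<ge> 2 * N y"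
    and h: "h \<in> carrier G" "h \<noteq> \<one>" "N h = 0"
    and b: "b \<in> carrier G" "N b \<noteq> 0"
    and T: "group_topology G T" and complete: "completely_metrizable_space T"
  shows "T = discrete_topology (carrier G)"
proof (rule ccontr)
  assume not_discrete: "T \<noteq> discrete_topology (carrier G)"
  have top: "topspace T = carrier G"
    using T by (simp add: group_topology_def)
  \<comment> \<open>If \<open>N\<close> vanished on \<open>U\<close>, it would vanish at both \<open>x\<close> and \<open>b x b\<inverse>\<close> for all \<open>x\<close> in
    \<open>U \<inter> b\<inverse> U b\<close>; the hypothesis on conjugates leaves only \<open>x = \<one>\<close>, so \<open>{\<one>}\<close> would be open.\<close>
  have long_near_one: "\<exists>g \<in> {g \<in> carrier G. N g \<noteq> 0}. g \<in> U" if U: "openin T U" "\<one> \<in> U" for U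
  proof (rule ccontr)
    assume short: "\<not> (\<exists>g \<in> {g \<in> carrier G. N g \<noteq> 0}. g \<in> U)"
    have UG: "U \<subseteq> carrier G"
      using openin_subset[OF U(1)] top by simp
    have "continuous_map T T (\<lambda>x. b \<otimes> x \<otimes> inv b)"
      using T b by (intro group_continuous_intros) auto
    from openin_continuous_map_preimage_gen[OF this U(1) U(1)]
    have "openin T {x \<in> U. b \<otimes> x \<otimes> inv b \<in> U}" .
    moreover have "x = \<one>" if x: "x \<in> U" "b \<otimes> x \<otimes> inv b \<in> U" for x
    proof (rule ccontr)
      assume "x \<noteq> \<one>"
      with x short UG b have "N (b \<otimes> x \<otimes> inv b) \<ge> 2 * N b"
        by (intro N_conj) auto
      moreover have "N (b \<otimes> x \<otimes> inv b) = 0"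
        using x(2) short UG by auto
      ultimately show False
        using b by simp
    qed
    moreover have "b \<otimes> \<one> \<otimes> inv b \<in> U"
      using U(2) b by simp
    ultimately have "openin T {x \<in> U. b \<otimes> x \<otimes> inv b \<in> U}" "{x \<in> U. b \<otimes> x \<otimes> inv b \<in> U} = {\<one>}"
      using U(2) by blast+
    then have "openin T {\<one>}"
      by simp
    then show False
      using not_discrete discrete_if_openin_one[OF T] by blast
  qed

  define \<phi> where "\<phi> y = y \<otimes> h \<otimes> inv y \<otimes> inv h" for y
  have \<phi>_closed: "\<phi> y \<in> carrier G" if "y \<in> carrier G" for y
    using that h by (simp add: \<phi>_def)
  have \<phi>_one: "\<phi> \<one> = \<one>"
    using h by (simp add: \<phi>_def)
  have \<phi>_doubles: "N (\<phi> y) \<ge> 2 * N y" if y: "y \<in> carrier G" for y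
  proof -
    have "y \<otimes> h \<otimes> inv y = \<phi> y \<otimes> h"
      using y h by (simp add: \<phi>_def m_assoc)
    then have "N (y \<otimes> h \<otimes> inv y) \<le> N (\<phi> y)"
      using N_mult[OF \<phi>_closed[OF y] h(1)] h(3) by simp
    then show ?thesis
      using N_conj[OF h y] by simp
  qed
  have \<phi>_cont: "continuous_map T T \<phi>"
    unfolding \<phi>_def using T h by (intro group_continuous_intros) auto
  have iter_closed: "(\<phi> ^^ k) y \<in> carrier G" if "y \<in> carrier G" for k y
    using that by (induction k) (auto simp: \<phi>_closed)
  have iter_one: "(\<phi> ^^ k) \<one> = \<one>" for k
    by (induction k) (auto simp: \<phi>_one)
  have iter_N: "N ((\<phi> ^^ k) y) \<ge> 2 ^ k * N y" if y: "y \<in> carrier G" for k y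
  proof (induction k)
    case (Suc k)
    then show ?case
      using \<phi>_doubles[OF iter_closed[OF y], of k] by simp
  qed simp
  have iter_cont: "continuous_map T T (\<phi> ^^ k)" for k
  proof (induction k)
    case (Suc k)
    then show ?case
      using continuous_map_compose[OF Suc \<phi>_cont] by (simp add: o_def)
  qed (simp add: id_def)

  \<comment> \<open>The exponent satisfies \<open>2 ^ Suc (N g) \<ge> N g + 2\<close>: the growth under iteration absorbs the
    factor \<open>g\<close> and leaves a gain of at least 1.\<close>
  define F where "F g y = g \<otimes> (\<phi> ^^ Suc (N g)) y" for g y
  have F_cont: "continuous_map T T (F g)" if "g \<in> {g \<in> carrier G. N g \<noteq> 0}" for g
    unfolding F_def[abs_def] using that
    by (intro group_continuous_intros[OF T] iter_cont) auto
  have F_small: "\<exists>g \<in> {g \<in> carrier G. N g \<noteq> 0}. F g \<one> \<in> U" if "openin T U" "\<one> \<in> U" for U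
    using long_near_one[OF that] by (auto simp: F_def iter_one simp del: funpow.simps)
  have one_mem: "\<one> \<in> topspace T"
    by (simp add: top)
  have "\<exists>g x. \<forall>n::nat. g n \<in> {g \<in> carrier G. N g \<noteq> 0} \<and> x n \<in> topspace T
      \<and> x n = F (g n) (x (Suc n))"
    by (rule nested_equations_solvable[OF complete one_mem F_cont F_small])
  then obtain g x where gx: "\<forall>n::nat. g n \<in> {g \<in> carrier G. N g \<noteq> 0} \<and> x n \<in> topspace T
      \<and> x n = F (g n) (x (Suc n))"
    by (elim exE)
  have g: "g n \<in> carrier G" "N (g n) \<noteq> 0" and x: "x n \<in> carrier G" for n
    using gx unfolding top by blast+
  define y where "y n = (\<phi> ^^ Suc (N (g n))) (x (Suc n))" for n
  have y: "y n \<in> carrier G" for n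
    unfolding y_def by (rule iter_closed[OF x])
  have x_eq: "x n = g n \<otimes> y n" for n
    using gx unfolding y_def F_def by blast

  have descent: "N (x n) > N (x (Suc n))" if pos: "N (x (Suc n)) \<noteq> 0" for n
  proof -
    define p where "p = N (x (Suc n))"
    have "y n = inv (g n) \<otimes> x n"
      using g y by (simp add: x_eq[of n] m_assoc[symmetric])
    then have "N (y n) \<le> N (g n) + N (x n)"
      using N_mult[of "inv (g n)" "x n"] N_inv g(1) x by simp
    moreover have "N (g n) < 2 ^ N (g n)"
      by (rule less_exp)
    then have "N (g n) + 2 \<le> 2 ^ Suc (N (g n))"
      unfolding power_Suc by linarith
    then have "(N (g n) + 2) * p \<le> 2 ^ Suc (N (g n)) * p"
      by (rule mult_le_mono1)
    moreover have "\<dots> \<le> N (y n)"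
      unfolding y_def p_def by (rule iter_N[OF x])
    moreover have "N (g n) \<le> N (g n) * p" "p > 0"
      using pos by (auto simp: p_def)
    moreover have "(N (g n) + 2) * p = N (g n) * p + 2 * p"
      by (rule add_mult_distrib)
    ultimately have "p < N (x n)"
      by linarith
    then show ?thesis
      by (simp add: p_def)
  qed
  \<comment> \<open>If \<open>x (Suc n)\<close> had length 0, then so would \<open>y n\<close>, and \<open>x n = g n \<otimes> y n\<close> would be at
    least as long as \<open>g n\<close>.\<close>
  have x_long: "N (x n) \<noteq> 0" for n
  proof (cases "N (x (Suc n)) = 0")
    case True
    have \<phi>_short: "N (\<phi> z) = 0" if z: "N z = 0" "z \<in> carrier G" for z
      using N_mult[of z h] N_mult[of "z \<otimes> h" "inv z"] N_mult[of "z \<otimes> h \<otimes> inv z" "inv h"]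
        N_inv[of z] N_inv[of h] z h by (simp add: \<phi>_def)
    have "N ((\<phi> ^^ k) (x (Suc n))) = 0" for k
      using True by (induction k) (auto simp: \<phi>_short iter_closed x)
    then have "N (inv (y n)) = 0"
      using N_inv y by (simp add: y_def del: funpow.simps)
    moreover have "g n = x n \<otimes> inv (y n)"
      using g y by (simp add: x_eq[of n] m_assoc)
    ultimately have "N (g n) \<le> N (x n)"
      using N_mult[OF x inv_closed[OF y], of n n] by simp
    then show ?thesis
      using g(2)[of n] by simp
  next
    case False
    then show ?thesis
      using descent[of n] by simp
  qed
  have "N (x 0) \<ge> N (x n) + n" for n
  proof (induction n)
    case (Suc n)
    then show ?case
      using descent[OF x_long, of n] by linarith
  qed simp
  from this[of "Suc (N (x 0))"] show False
    by simp
qed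

section \<open>The number of letters outside one factor\<close>

definition letters_outside :: "'i \<Rightarrow> ('i \<times> 'g) list \<Rightarrow> nat"
  where "letters_outside \<alpha> w = length (filter (\<lambda>l. fst l \<noteq> \<alpha>) w)"

lemma letters_outside_simps [simp]:
  "letters_outside \<alpha> [] = 0"
  "letters_outside \<alpha> (l # w) = (if fst l = \<alpha> then 0 else 1) + letters_outside \<alpha> w"
  "letters_outside \<alpha> (u @ v) = letters_outside \<alpha> u + letters_outside \<alpha> v"
  by (auto simp: letters_outside_def)

lemma letters_outside_prepend_le:
  "letters_outside \<alpha> (prepend G (a, g) w) \<le> (if a = \<alpha> then 0 else 1) + letters_outside \<alpha> w"
  by (cases w) auto

lemma letters_outside_mult_le:
  "letters_outside \<alpha> (foldr (prepend G) u v) \<le> letters_outside \<alpha> u + letters_outside \<alpha> v"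
proof (induction u)
  case (Cons l u)
  then show ?case
    using letters_outside_prepend_le[of \<alpha> G "fst l" "snd l" "foldr (prepend G) u v"] by simp
qed simp

definition word_inv :: "('i \<Rightarrow> ('g, 'm) monoid_scheme) \<Rightarrow> ('i \<times> 'g) list \<Rightarrow> ('i \<times> 'g) list"
  where "word_inv G w = rev (map (\<lambda>(a, g). (a, inv\<^bsub>G a\<^esub> g)) w)"

lemma letters_outside_word_inv [simp]: "letters_outside \<alpha> (word_inv G w) = letters_outside \<alpha> w"
  by (induction w) (auto simp: word_inv_def)

lemma reduced_words_appendD:
  assumes "u @ v \<in> reduced_words A G"
  shows "u \<in> reduced_words A G" "v \<in> reduced_words A G"
  using assms by (auto simp: reduced_words_def distinct_adj_append_iff)

lemma mult_eq_append:
  assumes "u @ v \<in> reduced_words A G"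
  shows "foldr (prepend G) u v = u @ v"
  using assms
proof (induction u)
  case (Cons l u)
  then show ?case
    using prepend_reduced[of "fst l" "snd l" "u @ v" A G]
      reduced_words_Cons[of "fst l" "snd l" "u @ v" A G] by simp
qed simp

context
  fixes A :: "'i set" and G :: "'i \<Rightarrow> ('g, 'm) monoid_scheme"
  assumes grp: "\<And>a. a \<in> A \<Longrightarrow> group (G a)"
begin

lemma word_inv_reduced:
  assumes "w \<in> reduced_words A G"
  shows "word_inv G w \<in> reduced_words A G"
proof -
  have "map fst (word_inv G w) = rev (map fst w)"
    by (simp add: word_inv_def rev_map case_prod_unfold o_def)
  moreover have "a \<in> A \<and> g \<in> carrier (G a) \<and> g \<noteq> \<one>\<^bsub>G a\<^esub>" if ag: "(a, g) \<in> set (word_inv G w)" for a g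
  proof -
    obtain k where k: "(a, k) \<in> set w" "g = inv\<^bsub>G a\<^esub> k"
      using ag by (auto simp: word_inv_def)
    then have k': "a \<in> A" "k \<in> carrier (G a)" "k \<noteq> \<one>\<^bsub>G a\<^esub>"
      using assms by (auto simp: reduced_words_def)
    interpret group "G a" using k'(1) by (rule grp)
    show ?thesis
      using k' k(2) by (simp add: inv_eq_1_iff)
  qed
  ultimately show ?thesis
    using assms by (auto simp: reduced_words_def)
qed

lemma word_inv_mult:
  assumes "w \<in> reduced_words A G"
  shows "foldr (prepend G) (word_inv G w) w = []"
  using assms
proof (induction w)
  case Nil
  then show ?case by (simp add: word_inv_def)
next
  case (Cons l w)
  obtain a g where l: "l = (a, g)" by (cases l)
  have ag: "a \<in> A" "g \<in> carrier (G a)" "w \<in> reduced_words A G"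
    using Cons l by (auto simp: reduced_words_Cons)
  interpret group "G a" using ag(1) by (rule grp)
  have "prepend G (a, inv\<^bsub>G a\<^esub> g) (l # w) = prepend G (a, inv\<^bsub>G a\<^esub> g) (prepend G (a, g) w)"
    using prepend_reduced[of a g w A G] Cons.prems l by simp
  also have "\<dots> = w"
    using ag prepend_prepend[OF grp ag(1) inv_closed[OF ag(2)] ag(2,3)] by (simp add: prepend_one)
  finally show ?case
    using Cons.IH[OF ag(3)] by (simp add: word_inv_def l)
qed

lemma inv_free_product:
  assumes "w \<in> reduced_words A G"
  shows "inv\<^bsub>free_product A G\<^esub> w = word_inv G w"
  by (rule group.inv_equality[OF group_free_product[OF grp]])
    (use word_inv_mult[OF assms] word_inv_reduced[OF assms] assms in \<open>auto simp: free_product_def\<close>)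

text \<open>
  As \<open>z\<close> does not end in the factor \<open>\<alpha>\<close>, its inverse does not begin there, so the concatenation of
  \<open>z\<close>, the letter and the inverse of \<open>z\<close> is reduced.
\<close>

lemma letters_outside_conjugate_letter:
  assumes z: "z \<in> reduced_words A G" "z = [] \<or> fst (last z) \<noteq> \<alpha>"
    and h: "\<alpha> \<in> A" "h \<in> carrier (G \<alpha>)" "h \<noteq> \<one>\<^bsub>G \<alpha>\<^esub>"
  shows "letters_outside \<alpha> (foldr (prepend G) z (foldr (prepend G) [(\<alpha>, h)] (word_inv G z)))
           = 2 * letters_outside \<alpha> z"
proof -
  have "map fst (word_inv G z) = rev (map fst z)"
    by (simp add: word_inv_def rev_map case_prod_unfold o_def)
  moreover have "z = [] \<or> last (map fst z) \<noteq> \<alpha>"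
    using z(2) by (auto simp: last_map)
  ultimately have "distinct_adj (map fst (z @ (\<alpha>, h) # word_inv G z))"
    using z(1) by (cases "z = []")
      (auto simp: reduced_words_def distinct_adj_append_iff distinct_adj_Cons hd_rev)
  then have "z @ ((\<alpha>, h) # word_inv G z) \<in> reduced_words A G"
    using z(1) h word_inv_reduced[OF z(1)] by (auto simp: reduced_words_def)
  then have "foldr (prepend G) z (foldr (prepend G) [(\<alpha>, h)] (word_inv G z))
      = z @ ((\<alpha>, h) # word_inv G z)"
    using mult_eq_append[of "[(\<alpha>, h)]" "word_inv G z" A G] mult_eq_append[of z]
      reduced_words_appendD(2) by fastforce
  then show ?thesis
    by simp
qed

lemma letters_outside_eq_0D:
  assumes "w \<in> reduced_words A G" "letters_outside \<alpha> w = 0" "w \<noteq> []"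
  obtains h where "w = [(\<alpha>, h)]" "\<alpha> \<in> A" "h \<in> carrier (G \<alpha>)" "h \<noteq> \<one>\<^bsub>G \<alpha>\<^esub>"
proof (cases w)
  case (Cons l w')
  then show ?thesis
    using assms that by (cases l; cases w') (auto simp: reduced_words_Cons split: if_splits)
qed (use assms in simp)

text \<open>
  A last letter \<open>s\<close> of \<open>y\<close> in the factor \<open>\<alpha>\<close> only replaces the letter \<open>h\<close> by its conjugate
  \<open>s h s\<inverse>\<close>, which is again a non-trivial element of that factor; so
  \<open>letters_outside_conjugate_letter\<close> applies to \<open>y\<close> without this letter.
\<close>

lemma letters_outside_conjugate:
  assumes w: "w \<in> reduced_words A G" "w \<noteq> []" "letters_outside \<alpha> w = 0" and y: "y \<in> reduced_words A G"
  shows "letters_outside \<alpha> (y \<otimes>\<^bsub>free_product A G\<^esub> w \<otimes>\<^bsub>free_product A G\<^esub> inv\<^bsub>free_product A G\<^esub> y)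
           = 2 * letters_outside \<alpha> y"
proof -
  let ?P = "free_product A G"
  interpret P: group ?P by (rule group_free_product[OF grp])
  have carr: "carrier ?P = reduced_words A G" and mult: "\<And>u v. u \<otimes>\<^bsub>?P\<^esub> v = foldr (prepend G) u v"
    by (simp_all add: free_product_def)
  obtain h where h: "w = [(\<alpha>, h)]" "\<alpha> \<in> A" "h \<in> carrier (G \<alpha>)" "h \<noteq> \<one>\<^bsub>G \<alpha>\<^esub>"
    using letters_outside_eq_0D[OF w(1,3,2)] .
  interpret Ga: group "G \<alpha>" using h(2) by (rule grp)
  have conj: "letters_outside \<alpha> (z \<otimes>\<^bsub>?P\<^esub> [(\<alpha>, k)] \<otimes>\<^bsub>?P\<^esub> inv\<^bsub>?P\<^esub> z) = 2 * letters_outside \<alpha> z"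
    if z: "z \<in> reduced_words A G" "z = [] \<or> fst (last z) \<noteq> \<alpha>"
      and k: "k \<in> carrier (G \<alpha>)" "k \<noteq> \<one>\<^bsub>G \<alpha>\<^esub>" for z k
  proof -
    have "[(\<alpha>, k)] \<in> carrier ?P"
      using h k by (simp add: carr reduced_words_Cons)
    then have "z \<otimes>\<^bsub>?P\<^esub> [(\<alpha>, k)] \<otimes>\<^bsub>?P\<^esub> inv\<^bsub>?P\<^esub> z = z \<otimes>\<^bsub>?P\<^esub> ([(\<alpha>, k)] \<otimes>\<^bsub>?P\<^esub> word_inv G z)"
      using z(1) word_inv_reduced[OF z(1)]
      by (simp add: inv_free_product carr P.m_assoc)
    then show ?thesis
      using letters_outside_conjugate_letter[OF z h(2) k] unfolding mult by simp
  qed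
  show ?thesis
  proof (cases "y = [] \<or> fst (last y) \<noteq> \<alpha>")
    case True
    then show ?thesis
      using conj[OF y _ h(3,4)] h(1) by simp
  next
    case False
    define z where "z = butlast y"
    obtain s where ys: "y = z @ [(\<alpha>, s)]"
      using False unfolding z_def by (metis append_butlast_last_id prod.collapse)
    have z: "z \<in> reduced_words A G" and s: "[(\<alpha>, s)] \<in> reduced_words A G"
      using reduced_words_appendD y ys by blast+
    have s': "s \<in> carrier (G \<alpha>)" "s \<noteq> \<one>\<^bsub>G \<alpha>\<^esub>"
      using s by (auto simp: reduced_words_Cons)
    have z_end: "z = [] \<or> fst (last z) \<noteq> \<alpha>"
      using y ys by (auto simp: reduced_words_def distinct_adj_append_iff last_map)
    have y_eq: "y = z \<otimes>\<^bsub>?P\<^esub> [(\<alpha>, s)]"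
      using mult_eq_append y ys mult by metis
    define k where "k = s \<otimes>\<^bsub>G \<alpha>\<^esub> h \<otimes>\<^bsub>G \<alpha>\<^esub> inv\<^bsub>G \<alpha>\<^esub> s"
    have k: "k \<in> carrier (G \<alpha>)" "k \<noteq> \<one>\<^bsub>G \<alpha>\<^esub>"
      using s' h unfolding k_def
      by (auto simp: Ga.inv_solve_right' Ga.inv_solve_right)
    have incl: "free_product_incl G \<alpha> \<in> hom (G \<alpha>) ?P"
      by (rule free_product_incl_hom[OF grp h(2)])
    have letter: "free_product_incl G \<alpha> g = [(\<alpha>, g)]" if "g \<noteq> \<one>\<^bsub>G \<alpha>\<^esub>" for g
      using that by (simp add: free_product_incl_def)
    interpret incl: group_hom "G \<alpha>" ?P "free_product_incl G \<alpha>"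
      by unfold_locales (rule incl)
    have "[(\<alpha>, s)] \<otimes>\<^bsub>?P\<^esub> w \<otimes>\<^bsub>?P\<^esub> inv\<^bsub>?P\<^esub> [(\<alpha>, s)] = [(\<alpha>, k)]"
      using s' h k(2) incl.hom_inv[OF s'(1)] by (simp add: k_def letter[symmetric] incl.hom_mult)
    then have "y \<otimes>\<^bsub>?P\<^esub> w \<otimes>\<^bsub>?P\<^esub> inv\<^bsub>?P\<^esub> y = z \<otimes>\<^bsub>?P\<^esub> [(\<alpha>, k)] \<otimes>\<^bsub>?P\<^esub> inv\<^bsub>?P\<^esub> z"
      using z s w(1) unfolding y_eq
      by (metis P.inv_mult_group P.inv_closed P.m_assoc P.m_closed carr)
    then show ?thesis
      using conj[OF z z_end k] ys by simp
  qed
qed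

end

theorem theorem1p6:
  fixes A :: "'i set"
    and G :: "'i \<Rightarrow> ('g, 'm) monoid_scheme"
    and T :: "('i \<times> 'g) list topology"
  assumes "\<exists>a \<in> A. \<exists>b \<in> A. a \<noteq> b"
    and "\<And>a. a \<in> A \<Longrightarrow> group (G a)"
    and "\<And>a. a \<in> A \<Longrightarrow> carrier (G a) \<noteq> {\<one>\<^bsub>G a\<^esub>}"
    and "group_topology (free_product A G) T"
    and "completely_metrizable_space T"
  shows "T = discrete_topology (carrier (free_product A G))"
proof -
  let ?P = "free_product A G"
  interpret P: group ?P by (rule group_free_product[OF assms(2)])
  obtain \<alpha> \<beta> where ab: "\<alpha> \<in> A" "\<beta> \<in> A" "\<alpha> \<noteq> \<beta>"
    using assms(1) by blast
  have nontrivial: "\<exists>g \<in> carrier (G a). g \<noteq> \<one>\<^bsub>G a\<^esub>" if "a \<in> A" for a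
    using assms(3)[OF that] monoid.one_closed[OF group.is_monoid[OF assms(2)[OF that]]] by blast
  obtain h k where h: "h \<in> carrier (G \<alpha>)" "h \<noteq> \<one>\<^bsub>G \<alpha>\<^esub>" and k: "k \<in> carrier (G \<beta>)" "k \<noteq> \<one>\<^bsub>G \<beta>\<^esub>"
    using nontrivial ab by blast
  show ?thesis
  proof (rule P.discrete_if_length_doubles[where N = "letters_outside \<alpha>" and h = "[(\<alpha>, h)]" and b = "[(\<beta>, k)]"])
    show "letters_outside \<alpha> (u \<otimes>\<^bsub>?P\<^esub> v) \<le> letters_outside \<alpha> u + letters_outside \<alpha> v" for u v
      by (simp add: free_product_def letters_outside_mult_le)
    show "letters_outside \<alpha> (inv\<^bsub>?P\<^esub> u) = letters_outside \<alpha> u" if "u \<in> carrier ?P" for u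
    proof -
      have "inv\<^bsub>?P\<^esub> u = word_inv G u"
        by (rule inv_free_product[OF assms(2)]) (use that in \<open>simp_all add: free_product_def\<close>)
      then show ?thesis
        by simp
    qed
    show "2 * letters_outside \<alpha> y \<le> letters_outside \<alpha> (y \<otimes>\<^bsub>?P\<^esub> w \<otimes>\<^bsub>?P\<^esub> inv\<^bsub>?P\<^esub> y)"
      if "w \<in> carrier ?P" "w \<noteq> \<one>\<^bsub>?P\<^esub>" "letters_outside \<alpha> w = 0" "y \<in> carrier ?P" for w y
    proof -
      have "letters_outside \<alpha> (y \<otimes>\<^bsub>?P\<^esub> w \<otimes>\<^bsub>?P\<^esub> inv\<^bsub>?P\<^esub> y) = 2 * letters_outside \<alpha> y"
        by (rule letters_outside_conjugate[OF assms(2)]) (use that in \<open>simp_all add: free_product_def\<close>)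
      then show ?thesis
        by simp
    qed
  qed (use ab h k assms(4,5) in \<open>auto simp: free_product_def reduced_words_Cons\<close>)
qed

end
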